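(* Let $q$ be a prime power and let $n,m\ge 2$ be integers with $m\ge n$. Let $C$ be an $\mathbb{F}_{q^m}$-$[n,k,d]$ code, and let $\Gamma$ be any $\mathbb{F}_q$-basis of $\mathbb{F}_{q^m}$. Then the following are equivalent. (1) $C$ is MRD. (2) The words of rank $d$ in $\Gamma(C)$ hold a trivial design over $\mathbb{F}_q$, i.e. the set $\{\sigma(X): X\in\Gamma(C),\ \mathrm{rk}(X)=d\}$ is the set of all $d$-dimensional subspaces of $\mathbb{F}_q^n$.
   Context: For a basis $\Gamma=\{\gamma_1,\dots,\gamma_m\}$ of $\mathbb{F}_{q^m}$ over $\mathbb{F}_q$ and $x\in\mathbb{F}_{q^m}^n$, $\Gamma(x)\in\mathbb{F}_q^{n\times m}$ is the matrix defined by $x_i=\sum_{j=1}^m\Gamma(x)_{ij}\gamma_j$ for $1\le i\le n$; for $C\subseteq \mathbb{F}_{q^m}^n$, $\Gamma(C)=\{\Gamma(x):x\in C\}$. A vector code is an $\mathbb{F}_{q^m}$-linear subspace $C\le\mathbb{F}_{q^m}^n$ with $C\ne\{0\}$ and $C\neq\mathbb{F}_{q^m}^n$. It is an $\mathbb{F}_{q^m}$-$[n,k,d]$ code if $\dim_{\mathbb{F}_{q^m}}C=k$ and $\Gamma(C)$ has minimum rank distance $d=\min\{\mathrm{rk}(X):X\in\Gamma(C),X\neq0\}$ (independent of the basis $\Gamma$). An $\mathbb{F}_q$-linear code $\mathcal{C}\le\mathbb{F}_q^{n\times m}$ with minimum rank distance $d$ is MRD if $\dim_{\mathbb{F}_q}\mathcal{C}=\max\{n,m\}(\min\{n,m\}-d+1)$.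 A vector code $C$ is MRD if $\Gamma(C)$ is MRD for some (equivalently, every) $\mathbb{F}_q$-basis $\Gamma$ of $\mathbb{F}_{q^m}$. The support $\sigma(X)\le\mathbb{F}_q^n$ of $X\in\mathbb{F}_q^{n\times m}$ is its column space. The trivial design (of block dimension $d$) is the one whose blocks are all $d$-dimensional subspaces of $\mathbb{F}_q^n$. *)

theory Defs
  imports "HOL-Analysis.Analysis"
begin

subsection \<open>Rank-metric matrix codes\<close>

(* For a finite field 'q, an n x m matrix over F_q is an element of 'q^'m^'n,
   with n = CARD('n) and m = CARD('m); q = CARD('q). *)

definition mat_scale :: "'q::field \<Rightarrow> 'q^'m^'n \<Rightarrow> 'q^'m^'n"
  where "mat_scale c X = (\<chi> i j. c * X $ i $ j)"

interpretation mat: vector_space mat_scale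
  by standard (simp_all add: mat_scale_def vec_eq_iff algebra_simps)

definition min_rank_distance :: "('q::{field,finite}^'m^'n) set \<Rightarrow> nat"
  where "min_rank_distance \<C> = Min (rank ` (\<C> - {0}))"

(* The truncated subtraction is harmless: for a nonzero code the minimum rank
   distance is at most min n m. The minimum distance is undefined for {0}. *)
definition MRD_code :: "('q::{field,finite}^'m^'n) set \<Rightarrow> bool"
  where "MRD_code \<C> \<longleftrightarrow> mat.subspace \<C> \<and> \<C> \<noteq> {0} \<and>
    mat.dim \<C> = max CARD('n) CARD('m) * (min CARD('n) CARD('m) - min_rank_distance \<C> + 1)"

definition support :: "'q::field^'m^'n \<Rightarrow> ('q^'n) set"
  where "support X = vec.span (columns X)"

definition supports_of_rank :: "nat \<Rightarrow> ('q::field^'m^'n) set \<Rightarrow> ('q^'n) set set"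
  where "supports_of_rank d \<C> = {support X |X. X \<in> \<C> \<and> rank X = d}"

definition trivial_design :: "nat \<Rightarrow> ('q::field^'n) set set"
  where "trivial_design d = {U. vec.subspace U \<and> vec.dim U = d}"

subsection \<open>Vector codes over an extension field\<close>

(* The extension is given by an embedding of the small field into the large one.
   Its degree m is the number of elements of the index type 'm of a basis. *)
locale finite_field_extension =
  fixes emb :: "'q::{field,finite} \<Rightarrow> 'Q::{field,finite}"
  assumes emb_1: "emb 1 = 1"
    and emb_add: "emb (a + b) = emb a + emb b"
    and emb_mult: "emb (a * b) = emb a * emb b"
begin

sublocale ext: vector_space "\<lambda>c x. emb c * x"
  by standard (simp_all add: emb_1 emb_add emb_mult algebra_simps)

definition is_basis :: "('m::finite \<Rightarrow> 'Q) \<Rightarrow> bool"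
  where "is_basis \<Gamma> \<longleftrightarrow> inj \<Gamma> \<and> ext.independent (range \<Gamma>) \<and> ext.span (range \<Gamma>) = UNIV"

definition coord_matrix :: "('m::finite \<Rightarrow> 'Q) \<Rightarrow> 'Q^'n \<Rightarrow> 'q^'m^'n"
  where "coord_matrix \<Gamma> x = (THE X. \<forall>i. x $ i = (\<Sum>j\<in>UNIV. emb (X $ i $ j) * \<Gamma> j))"

lemma coord_matrix_ex1:
  fixes \<Gamma> :: "'m::finite \<Rightarrow> 'Q" and x :: "'Q^'n"
  assumes "is_basis \<Gamma>"
  shows "\<exists>!X :: 'q^'m^'n. \<forall>i. x $ i = (\<Sum>j\<in>UNIV. emb (X $ i $ j) * \<Gamma> j)"
proof -
  have inj: "inj \<Gamma>" and ind: "ext.independent (range \<Gamma>)" and sp: "ext.span (range \<Gamma>) = UNIV"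
    using assms by (auto simp: is_basis_def)
  have reindex: "(\<Sum>v\<in>range \<Gamma>. emb (u v) * v) = (\<Sum>j\<in>UNIV. emb (u (\<Gamma> j)) * \<Gamma> j)" for u
    using inj by (simp add: sum.reindex)
  have ex: "\<exists>a. y = (\<Sum>j\<in>UNIV. emb (a j) * \<Gamma> j)" for y
  proof -
    have "y \<in> range (\<lambda>u. \<Sum>v\<in>range \<Gamma>. emb (u v) * v)"
      using sp ext.span_finite[of "range \<Gamma>"] by auto
    then obtain u where "y = (\<Sum>v\<in>range \<Gamma>. emb (u v) * v)" by auto
    then show ?thesis using reindex[of u] by auto
  qed
  have uniq: "a = b" if eq: "(\<Sum>j\<in>UNIV. emb (a j) * \<Gamma> j) = (\<Sum>j\<in>UNIV. emb (b j) * \<Gamma> j)" for a b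
  proof
    fix j
    define u where "u v = a (inv \<Gamma> v) - b (inv \<Gamma> v)" for v
    have "(\<Sum>v\<in>range \<Gamma>. emb (u v) * v) = (\<Sum>j\<in>UNIV. emb (a j) * \<Gamma> j) - (\<Sum>j\<in>UNIV. emb (b j) * \<Gamma> j)"
      unfolding reindex u_def using inj
      by (simp add: ext.scale_left_diff_distrib sum_subtractf)
    then have "(\<Sum>v\<in>range \<Gamma>. emb (u v) * v) = 0" using eq by simp
    then have "u (\<Gamma> j) = 0"
      using ext.independentD[OF ind, of "range \<Gamma>" u "\<Gamma> j"] by auto
    then show "a j = b j" using inj by (simp add: u_def)
  qed
  obtain a where a: "\<And>y. y = (\<Sum>j\<in>UNIV. emb (a y j) * \<Gamma> j)" using ex by metis
  show ?thesis
  proof (rule ex1I)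
    show "\<forall>i. x $ i = (\<Sum>j\<in>UNIV. emb ((\<chi> i j. a (x $ i) j) $ i $ j) * \<Gamma> j)"
      using a by simp
  next
    fix X :: "'q^'m^'n"
    assume X: "\<forall>i. x $ i = (\<Sum>j\<in>UNIV. emb (X $ i $ j) * \<Gamma> j)"
    have "($) (X $ i) = a (x $ i)" for i
      by (rule uniq) (metis X a)
    then show "X = (\<chi> i j. a (x $ i) j)" by (simp add: vec_eq_iff)
  qed
qed

definition vector_code :: "('Q^'n) set \<Rightarrow> bool"
  where "vector_code C \<longleftrightarrow> vec.subspace C \<and> C \<noteq> {0} \<and> C \<noteq> UNIV"

(* The extension degree is passed as a type argument; the minimum distance and the
   MRD property do not depend on the choice of the basis indexed by that type. *)
definition vector_code_params :: "'m::finite itself \<Rightarrow> ('Q^'n) set \<Rightarrow> nat \<Rightarrow> nat \<Rightarrow> bool"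
  where "vector_code_params _ C k d \<longleftrightarrow> vector_code C \<and> vec.dim C = k \<and>
    (\<exists>\<Gamma> :: 'm \<Rightarrow> 'Q. is_basis \<Gamma> \<and> min_rank_distance (coord_matrix \<Gamma> ` C) = d)"

definition MRD_vector_code :: "'m::finite itself \<Rightarrow> ('Q^'n) set \<Rightarrow> bool"
  where "MRD_vector_code _ C \<longleftrightarrow> vector_code C \<and>
    (\<exists>\<Gamma> :: 'm \<Rightarrow> 'Q. is_basis \<Gamma> \<and> MRD_code (coord_matrix \<Gamma> ` C))"

end

end

theory Submission
  imports Defs
begin

text \<open>
  Write \<open>n = CARD('n)\<close>, \<open>m = CARD('m)\<close>, \<open>q = CARD('q)\<close> and \<open>Q = CARD('Q) = q ^ m\<close>. Passing to
  coordinates is injective, so for \<open>n \<le> m\<close> being MRD is a statement about the number of codewords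
  (\<open>MRD_code_iff_card\<close>): \<open>card C = Q ^ (n - d + 1)\<close>. This form does not mention the basis, and the
  minimum distance does not depend on it either, since a change of basis acts on the columns of
  a coordinate matrix and preserves its column space.

  If \<open>card C = Q ^ (n - d + 1)\<close> and \<open>U\<close> is a subspace of dimension \<open>d\<close> over the small field, then the
  words whose support lies in \<open>U\<close> form the extension of scalars of \<open>U\<close>, which has \<open>Q ^ d\<close> elements.
  Since \<open>(n - d + 1) + d > n\<close>, it meets \<open>C\<close> in a nonzero word
  (\<open>exists_word_supported_in_subspace\<close>). The support of this word has dimension at least \<open>d\<close> and
  lies in \<open>U\<close>, so it is \<open>U\<close>.

  Conversely, fix a set \<open>T\<close> of \<open>d - 1\<close> coordinates. If every subspace of dimension \<open>d\<close> is a support,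
  then for each \<open>i \<notin> T\<close> some codeword has support spanned by the unit vectors of \<open>insert i T\<close>.
  Such a word vanishes outside \<open>insert i T\<close> but not at \<open>i\<close>, because otherwise its rank would be at
  most \<open>d - 1\<close>. Outside \<open>T\<close> these \<open>n - d + 1\<close> words form a diagonal matrix with nonzero diagonal,
  so they are linearly independent and \<open>card C \<ge> Q ^ (n - d + 1)\<close>
  (\<open>card_ge_if_supports_trivial\<close>). The opposite inequality is the Singleton bound.
\<close>

section \<open>Linear algebra over finite fields\<close>

lemma card_subspace_finite_field:
  fixes scale :: "'a::{field,finite} \<Rightarrow> 'b::ab_group_add \<Rightarrow> 'b"
  assumes "vector_space scale"
    and sub: "module.subspace scale V" and fin: "finite V"
  shows "card V = CARD('a) ^ vector_space.dim scale V"
proof -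
  interpret vector_space scale by fact
  obtain B where B: "B \<subseteq> V" "independent B" "V \<subseteq> span B" "card B = dim V"
    using basis_exists by blast
  have fB: "finite B" using B fin finite_subset by blast
  have V: "V = span B" using B sub span_minimal by blast
  define \<phi> where "\<phi> u = (\<Sum>b\<in>B. scale (u b) b)" for u
  have "\<phi> ` (B \<rightarrow>\<^sub>E UNIV) = V"
  proof -
    have "\<phi> u = \<phi> (restrict u B)" for u unfolding \<phi>_def by (rule sum.cong) auto
    then have "range \<phi> \<subseteq> \<phi> ` (B \<rightarrow>\<^sub>E UNIV)" by (metis (no_types, lifting) UNIV_I image_iff image_subsetI restrict_PiE_iff)
    then show ?thesis unfolding V span_finite[OF fB] \<phi>_def[abs_def] by auto
  qed
  moreover have "inj_on \<phi> (B \<rightarrow>\<^sub>E UNIV)"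
  proof (rule inj_onI)
    fix u v assume u: "u \<in> B \<rightarrow>\<^sub>E UNIV" and v: "v \<in> B \<rightarrow>\<^sub>E UNIV" and eq: "\<phi> u = \<phi> v"
    have "(\<Sum>b\<in>B. scale (u b - v b) b) = 0"
      using eq by (simp add: \<phi>_def scale_left_diff_distrib sum_subtractf)
    then have "u b - v b = 0" if "b \<in> B" for b
      using independentD[OF B(2) fB, of "\<lambda>b. u b - v b"] that by auto
    then show "u = v" using u v by (intro PiE_ext) auto
  qed
  ultimately have "card V = card (B \<rightarrow>\<^sub>E (UNIV::'a set))" by (metis card_image)
  then show ?thesis using card_PiE[OF fB, of "\<lambda>_. UNIV::'a set"] B(4) by simp
qed

text \<open>
  Rank factorisation: a basis \<open>B\<close> of the column space writes \<open>A\<close> as a product with inner dimension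
  \<open>card B\<close>, and the rows of the right-hand factor span the row space of \<open>A\<close>.
\<close>

lemma dim_rows_le_dim_columns_field:
  fixes A :: "'a::field^'m^'n"
  shows "vec.dim (rows A) \<le> vec.dim (columns A)"
proof -
  obtain B where B: "B \<subseteq> columns A" "vec.independent B" "columns A \<subseteq> vec.span B"
    "card B = vec.dim (columns A)" using vec.basis_exists by blast
  have fB: "finite B" using B vec.finiteI_independent by blast
  have "\<exists>u. column j A = (\<Sum>b\<in>B. u b *s b)" for j
    using B(3) unfolding vec.span_finite[OF fB] columns_def by blast
  then obtain u where u: "\<And>j. column j A = (\<Sum>b\<in>B. u j b *s b)" by metis
  \<comment> \<open>The \<open>c b\<close> are the rows of the right-hand factor.\<close>
  define c where "c b = (\<chi> j. u j b)" for b
  have "row i A = (\<Sum>b\<in>B. b $ i *s c b)" for i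
  proof -
    have "A $ i $ j = (\<Sum>b\<in>B. b $ i * u j b)" for j
      using arg_cong[OF u[of j], of "\<lambda>v. v $ i"]
      by (simp add: column_def sum_component mult.commute)
    then show ?thesis by (simp add: vec_eq_iff row_def c_def sum_component)
  qed
  moreover have "(\<Sum>b\<in>B. b $ i *s c b) \<in> vec.span (c ` B)" for i
    by (rule vec.span_sum, rule vec.span_scale, rule vec.span_base) simp
  ultimately have "rows A \<subseteq> vec.span (c ` B)"
    by (auto simp: rows_def)
  then have "vec.dim (rows A) \<le> card (c ` B)" by (rule vec.dim_le_card) (simp add: fB)
  also have "\<dots> \<le> card B" by (rule card_image_le[OF fB])
  finally show ?thesis using B by simp
qed

text \<open>
  The rank is defined as the dimension of the row space, the support as the column space; the
  previous inequality, for \<open>A\<close> and for its transpose, reconciles the two.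
\<close>

lemma rank_eq_dim_support:
  fixes A :: "'a::field^'m^'n"
  shows "rank A = vec.dim (support A)"
  using dim_rows_le_dim_columns_field[of A] dim_rows_le_dim_columns_field[of "transpose A"]
  by (simp add: row_rank_def_gen support_def)

lemma subspace_support: "vec.subspace (support A)"
  by (simp add: support_def)

lemma span_axes_vanish:
  fixes T :: "'n::finite set" and v :: "'a::field^'n"
  assumes "v \<in> vec.span ((\<lambda>t. axis t 1) ` T)" and "i \<notin> T"
  shows "v $ i = 0"
proof -
  have "vec.span ((\<lambda>t. axis t 1) ` T) \<subseteq> {v :: 'a^'n. v $ i = 0}"
    by (rule vec.span_minimal) (use assms(2) in \<open>auto simp: axis_def vec.subspace_def\<close>)
  with assms(1) show ?thesis by auto
qed

lemma dim_span_axes: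
  fixes T :: "'n::finite set"
  shows "vec.dim (vec.span ((\<lambda>t. axis t (1::'a::field)) ` T)) = card T"
proof -
  have inj: "inj (\<lambda>t::'n. axis t (1::'a))" by (auto simp: inj_def axis_eq_axis)
  have "vec.independent ((\<lambda>t::'n. axis t (1::'a)) ` T)"
    by (rule vec.independent_mono[OF independent_cart_basis]) (auto simp: cart_basis_def)
  then show ?thesis
    by (simp add: vec.dim_eq_card_independent card_image inj_on_subset[OF inj])
qed

section \<open>Coordinates of words over the extension field\<close>

context finite_field_extension
begin

lemma emb_0: "emb 0 = 0"
  using emb_add[of 0 0] by (metis add_0 add_left_cancel add.right_neutral)

lemma emb_sum: "emb (\<Sum>i\<in>I. f i) = (\<Sum>i\<in>I. emb (f i))"
  by (induction I rule: infinite_finite_induct) (auto simp: emb_0 emb_add)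

context
  fixes \<Gamma> :: "'m::finite \<Rightarrow> 'Q"
  assumes basis: "is_basis \<Gamma>"
begin

lemma coord_matrix_expansion:
  fixes x :: "'Q^'n"
  shows "x $ i = (\<Sum>j\<in>UNIV. emb (coord_matrix \<Gamma> x $ i $ j) * \<Gamma> j)"
  using theI'[OF coord_matrix_ex1[OF basis, of x]] unfolding coord_matrix_def by blast

lemma coord_matrix_eqI:
  fixes x :: "'Q^'n"
  assumes "\<And>i. x $ i = (\<Sum>j\<in>UNIV. emb (X $ i $ j) * \<Gamma> j)"
  shows "coord_matrix \<Gamma> x = X"
  unfolding coord_matrix_def by (rule the1_equality[OF coord_matrix_ex1[OF basis]]) (use assms in blast)

lemma basis_expansion: "\<exists>Y. \<forall>l. y l = (\<Sum>j\<in>UNIV. emb (Y l j) * \<Gamma> j)"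
proof (intro exI allI)
  fix l
  show "y l = (\<Sum>j\<in>UNIV. emb (coord_matrix \<Gamma> (\<chi> i::1. y l) $ 1 $ j) * \<Gamma> j)"
    using coord_matrix_expansion[of "\<chi> i::1. y l" 1] by simp
qed

lemma coord_matrix_0: "coord_matrix \<Gamma> (0::'Q^'n) = 0"
  by (rule coord_matrix_eqI) (simp add: emb_0)

lemma inj_coord_matrix: "inj (coord_matrix \<Gamma> :: 'Q^'n \<Rightarrow> _)"
proof (rule injI)
  fix x y :: "'Q^'n" assume "coord_matrix \<Gamma> x = coord_matrix \<Gamma> y"
  then show "x = y"
    using coord_matrix_expansion[of x] coord_matrix_expansion[of y] by (simp add: vec_eq_iff)
qed

lemma coord_matrix_add:
  "coord_matrix \<Gamma> (x + y :: 'Q^'n) = coord_matrix \<Gamma> x + coord_matrix \<Gamma> y"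
  by (rule coord_matrix_eqI)
    (simp add: emb_add distrib_right sum.distrib flip: coord_matrix_expansion)

lemma coord_matrix_emb_scale:
  "coord_matrix \<Gamma> (emb c *s x :: 'Q^'n) = mat_scale c (coord_matrix \<Gamma> x)"
proof (rule coord_matrix_eqI)
  fix i
  show "(emb c *s x) $ i = (\<Sum>j\<in>UNIV. emb (mat_scale c (coord_matrix \<Gamma> x) $ i $ j) * \<Gamma> j)"
    \<comment> \<open>\<open>ext.scale_scale\<close> merges the factors that \<open>emb_mult\<close> splits, so simplification with both loops.\<close>
    using arg_cong[OF coord_matrix_expansion[of x i], of "\<lambda>y. emb c * y"]
    by (simp add: mat_scale_def emb_mult mult.assoc sum_distrib_left del: ext.scale_scale)
qed

lemma card_extension: "CARD('Q) = CARD('q) ^ CARD('m)"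
proof -
  have "ext.dim (UNIV :: 'Q set) = card (range \<Gamma>)"
    using basis ext.basis_card_eq_dim[of "range \<Gamma>" UNIV] by (auto simp: is_basis_def)
  also have "\<dots> = CARD('m)" using basis by (simp add: is_basis_def card_image)
  finally show ?thesis
    using card_subspace_finite_field[OF ext.vector_space_axioms, of UNIV] by simp
qed

lemma dim_coord_matrix_image:
  fixes C :: "('Q^'n) set"
  assumes "vec.subspace C"
  shows "mat.subspace (coord_matrix \<Gamma> ` C)"
    and "card C = CARD('q) ^ mat.dim (coord_matrix \<Gamma> ` C)"
proof -
  show sub: "mat.subspace (coord_matrix \<Gamma> ` C)"
    unfolding mat.subspace_def
  proof (intro conjI ballI allI)
    show "0 \<in> coord_matrix \<Gamma> ` C"
      using assms coord_matrix_0 vec.subspace_0 by (metis image_eqI)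
  next
    fix X Y assume "X \<in> coord_matrix \<Gamma> ` C" "Y \<in> coord_matrix \<Gamma> ` C"
    then show "X + Y \<in> coord_matrix \<Gamma> ` C"
      using vec.subspace_add[OF assms] by (auto simp flip: coord_matrix_add)
  next
    fix c X assume "X \<in> coord_matrix \<Gamma> ` C"
    then show "mat_scale c X \<in> coord_matrix \<Gamma> ` C"
      using vec.subspace_scale[OF assms] by (auto simp flip: coord_matrix_emb_scale)
  qed
  have "card C = card (coord_matrix \<Gamma> ` C)"
    by (simp add: card_image inj_on_subset[OF inj_coord_matrix])
  also have "\<dots> = CARD('q) ^ mat.dim (coord_matrix \<Gamma> ` C)"
    by (rule card_subspace_finite_field[OF mat.vector_space_axioms sub]) simp
  finally show "card C = CARD('q) ^ mat.dim (coord_matrix \<Gamma> ` C)" .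
qed

text \<open>
  The rule for bounding supports from above: expanding the large-field coefficients \<open>y l\<close> in the
  basis turns a combination of embedded small-field vectors into a matrix whose columns are
  small-field combinations of the same vectors.
\<close>

lemma support_combination_subset:
  fixes v :: "'i \<Rightarrow> 'q^'n" and x :: "'Q^'n"
  assumes x: "\<And>i. x $ i = (\<Sum>l\<in>I. emb (v l $ i) * y l)"
  shows "support (coord_matrix \<Gamma> x) \<subseteq> vec.span (v ` I)"
proof -
  obtain Y where Y: "\<And>l. y l = (\<Sum>j\<in>UNIV. emb (Y l j) * \<Gamma> j)"
    using basis_expansion[of y] by blast
  have "coord_matrix \<Gamma> x = (\<chi> i j. \<Sum>l\<in>I. v l $ i * Y l j)"
  proof (rule coord_matrix_eqI)
    fix i
    have "x $ i = (\<Sum>l\<in>I. \<Sum>j\<in>UNIV. emb (v l $ i * Y l j) * \<Gamma> j)"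
      by (simp add: x Y sum_distrib_left emb_mult mult.assoc del: ext.scale_scale)
    also have "\<dots> = (\<Sum>j\<in>UNIV. \<Sum>l\<in>I. emb (v l $ i * Y l j) * \<Gamma> j)" by (rule sum.swap)
    finally show "x $ i = (\<Sum>j\<in>UNIV. emb ((\<chi> i j. \<Sum>l\<in>I. v l $ i * Y l j) $ i $ j) * \<Gamma> j)"
      by (simp add: emb_sum sum_distrib_right)
  qed
  then have "column j (coord_matrix \<Gamma> x) = (\<Sum>l\<in>I. Y l j *s v l)" for j
    by (simp add: column_def vec_eq_iff sum_component mult.commute)
  moreover have "(\<Sum>l\<in>I. Y l j *s v l) \<in> vec.span (v ` I)" for j
    by (rule vec.span_sum, rule vec.span_scale, rule vec.span_base) simp
  ultimately have "columns (coord_matrix \<Gamma> x) \<subseteq> vec.span (v ` I)"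
    by (auto simp: columns_def)
  then show ?thesis by (simp add: support_def vec.span_minimal)
qed

text \<open>
  Independence survives extension of scalars: a relation with large-field coefficients splits,
  one basis coordinate at a time, into relations with small-field coefficients.
\<close>

lemma independent_over_extension:
  fixes B :: "('q^'n) set"
  assumes B: "vec.independent B" and zero: "\<And>i. (\<Sum>b\<in>B. emb (b $ i) * y b) = 0" and "b \<in> B"
  shows "y b = 0"
proof -
  have fB: "finite B" using B vec.finiteI_independent by blast
  obtain Y where Y: "\<And>b. y b = (\<Sum>j\<in>UNIV. emb (Y b j) * \<Gamma> j)"
    using basis_expansion[of y] by blast
  have "coord_matrix \<Gamma> (0::'Q^'n) = (\<chi> i j. \<Sum>b\<in>B. Y b j * b $ i)"
  proof (rule coord_matrix_eqI)
    fix i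
    have "0 = (\<Sum>b\<in>B. \<Sum>j\<in>UNIV. emb (Y b j * b $ i) * \<Gamma> j)"
      using zero[of i] by (simp add: Y sum_distrib_left emb_mult mult_ac del: ext.scale_scale)
    also have "\<dots> = (\<Sum>j\<in>UNIV. \<Sum>b\<in>B. emb (Y b j * b $ i) * \<Gamma> j)" by (rule sum.swap)
    finally show "(0::'Q^'n) $ i = (\<Sum>j\<in>UNIV. emb ((\<chi> i j. \<Sum>b\<in>B. Y b j * b $ i) $ i $ j) * \<Gamma> j)"
      by (simp add: emb_sum sum_distrib_right)
  qed
  then have "(\<Sum>b\<in>B. Y b j *s b) = 0" for j
    by (simp add: coord_matrix_0 vec_eq_iff sum_component)
  then have "Y b j = 0" for j
    using vec.independentD[OF B fB subset_refl, of "\<lambda>b. Y b j"] \<open>b \<in> B\<close> by auto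
  then show ?thesis by (simp add: Y emb_0)
qed

text \<open>
  For coordinate subspaces, the inclusion of supports can be read off the word itself. This is
  what links supports to the coordinatewise arguments below.
\<close>

lemma support_subset_span_axes_iff:
  fixes x :: "'Q^'n"
  shows "support (coord_matrix \<Gamma> x) \<subseteq> vec.span ((\<lambda>t. axis t 1) ` T) \<longleftrightarrow> (\<forall>i. i \<notin> T \<longrightarrow> x $ i = 0)"
proof (intro iffI allI impI)
  fix i assume sub: "support (coord_matrix \<Gamma> x) \<subseteq> vec.span ((\<lambda>t. axis t 1) ` T)" and i: "i \<notin> T"
  have "column j (coord_matrix \<Gamma> x) \<in> support (coord_matrix \<Gamma> x)" for j
    unfolding support_def by (rule vec.span_base) (auto simp: columns_def)
  then have "column j (coord_matrix \<Gamma> x) $ i = 0" for j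
    using span_axes_vanish[OF _ i] sub by blast
  then show "x $ i = 0"
    by (subst coord_matrix_expansion) (simp add: column_def emb_0)
next
  assume van: "\<forall>i. i \<notin> T \<longrightarrow> x $ i = 0"
  show "support (coord_matrix \<Gamma> x) \<subseteq> vec.span ((\<lambda>t. axis t 1) ` T)"
  proof (rule support_combination_subset)
    fix i
    have "(\<Sum>t\<in>T. emb (axis t 1 $ i) * x $ t) = (\<Sum>t\<in>T. if t = i then x $ t else 0)"
      by (rule sum.cong) (auto simp: axis_def emb_0 emb_1)
    then show "x $ i = (\<Sum>t\<in>T. emb (axis t 1 $ i) * x $ t)" using van by simp
  qed
qed

lemma rank_le_card_coordinates:
  fixes x :: "'Q^'n"
  assumes "\<And>i. i \<notin> T \<Longrightarrow> x $ i = 0"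
  shows "rank (coord_matrix \<Gamma> x) \<le> card T"
proof -
  have "support (coord_matrix \<Gamma> x) \<subseteq> vec.span ((\<lambda>t. axis t 1) ` T)"
    using assms by (simp add: support_subset_span_axes_iff)
  from vec.dim_subset[OF this] show ?thesis by (simp only: rank_eq_dim_support dim_span_axes)
qed

section \<open>The Singleton bound and words with prescribed support\<close>

text \<open>
  Deleting \<open>d - 1\<close> coordinates is injective on \<open>C\<close>: two words with the same image differ by a
  word supported on \<open>d - 1\<close> coordinates, whose rank is too small to be nonzero.
\<close>

lemma singleton_bound:
  fixes C :: "('Q^'n) set"
  assumes C: "vec.subspace C" and d: "1 \<le> d" "d \<le> CARD('n)"
    and min: "\<And>x. x \<in> C \<Longrightarrow> x \<noteq> 0 \<Longrightarrow> d \<le> rank (coord_matrix \<Gamma> x)"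
  shows "card C \<le> CARD('Q) ^ (CARD('n) - d + 1)"
proof -
  have "d - 1 \<le> CARD('n)" using d by simp
  then obtain T :: "'n set" where T: "card T = d - 1"
    by (rule obtain_subset_with_card_n)
  have cT: "card (- T) = CARD('n) - d + 1"
    using T d by (simp add: Compl_eq_Diff_UNIV card_Diff_subset)
  have "inj_on (\<lambda>x::'Q^'n. restrict (($) x) (- T)) C"
  proof (rule inj_onI)
    fix x y :: "'Q^'n"
    assume x: "x \<in> C" and y: "y \<in> C" and eq: "restrict (($) x) (- T) = restrict (($) y) (- T)"
    have "(x - y) $ i = 0" if "i \<notin> T" for i
      using fun_cong[OF eq, of i] that by simp
    then have "rank (coord_matrix \<Gamma> (x - y)) \<le> d - 1"
      using rank_le_card_coordinates[of T "x - y"] T by simp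
    then show "x = y"
      using min[of "x - y"] vec.subspace_diff[OF C x y] d by force
  qed
  then have "card C \<le> card (- T \<rightarrow>\<^sub>E (UNIV :: 'Q set))"
    by (rule card_inj_on_le) (auto intro: finite_PiE)
  then show ?thesis by (simp add: card_PiE cT)
qed

text \<open>
  Pigeonhole on sums \<open>x + \<psi> y\<close>, where \<open>x\<close> is a codeword and \<open>\<psi> y\<close> runs through the extension of
  scalars of \<open>U\<close>: two equal sums give a word in both sets, and it is nonzero because \<open>\<psi>\<close> is injective.
\<close>

lemma exists_word_supported_in_subspace:
  fixes C :: "('Q^'n) set" and U :: "('q^'n) set"
  assumes C: "vec.subspace C" and U: "vec.subspace U"
    and large: "CARD('Q) ^ CARD('n) < card C * CARD('Q) ^ vec.dim U"
  shows "\<exists>x\<in>C. x \<noteq> 0 \<and> support (coord_matrix \<Gamma> x) \<subseteq> U"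
proof -
  obtain B where B: "B \<subseteq> U" "vec.independent B" "U \<subseteq> vec.span B" "card B = vec.dim U"
    using vec.basis_exists by blast
  have fB: "finite B" using B vec.finiteI_independent by blast
  have spB: "vec.span B = U" using B U vec.span_minimal by blast
  define \<psi> where "\<psi> y = (\<chi> i. \<Sum>b\<in>B. emb (b $ i) * y b)" for y :: "'q^'n \<Rightarrow> 'Q"
  let ?P = "C \<times> (B \<rightarrow>\<^sub>E (UNIV :: 'Q set))"
  have "card (UNIV :: ('Q^'n) set) < card ?P"
    using large B(4) by (simp add: card_cartesian_product card_PiE[OF fB] CARD_vec)
  then have "\<not> inj_on (\<lambda>(x, y). x + \<psi> y) ?P"
    using card_inj_on_le[of "\<lambda>(x, y). x + \<psi> y" ?P UNIV] by auto
  then obtain p p' where p: "p \<in> ?P" "p' \<in> ?P" "p \<noteq> p'"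
    "(\<lambda>(x, y). x + \<psi> y) p = (\<lambda>(x, y). x + \<psi> y) p'"
    unfolding inj_on_def by blast
  obtain x y x' y' where "p = (x, y)" "p' = (x', y')" by (cases p, cases p')
  then have xy: "x \<in> C" "x' \<in> C" "y \<in> B \<rightarrow>\<^sub>E UNIV" "y' \<in> B \<rightarrow>\<^sub>E UNIV"
    "(x, y) \<noteq> (x', y')" "x + \<psi> y = x' + \<psi> y'"
    using p by simp_all
  \<comment> \<open>The common word is \<open>x - x' = \<psi> z\<close>; only \<open>x - x' \<noteq> 0\<close> remains, and \<open>x = x'\<close> would force \<open>y = y'\<close>.\<close>
  define z where "z b = y' b - y b" for b
  have z: "x - x' = \<psi> z"
    using xy(6) by (simp add: vec_eq_iff \<psi>_def z_def right_diff_distrib sum_subtractf algebra_simps)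
  have "x \<noteq> x'"
  proof
    assume "x = x'"
    then have "\<psi> z = 0" using z by simp
    then have "z b = 0" if "b \<in> B" for b
      using independent_over_extension[OF B(2), of z] that by (simp add: \<psi>_def vec_eq_iff)
    then have "y = y'" using xy by (intro PiE_ext[of y B _ y']) (auto simp: z_def)
    then show False using xy(5) \<open>x = x'\<close> by simp
  qed
  moreover have "support (coord_matrix \<Gamma> (x - x')) \<subseteq> vec.span ((\<lambda>b. b) ` B)"
    by (rule support_combination_subset) (simp add: z \<psi>_def)
  ultimately show ?thesis
    using vec.subspace_diff[OF C xy(1,2)] spB by (intro bexI[of _ "x - x'"]) auto
qed

text \<open>
  The blocks needed are the coordinate subspaces that share \<open>d - 1\<close> fixed coordinates \<open>T\<close>. Words
  with these supports are diagonal on the remaining coordinates, hence span a space of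
  dimension \<open>n - d + 1\<close> inside \<open>C\<close>.
\<close>

lemma card_ge_if_supports_trivial:
  fixes C :: "('Q^'n) set"
  assumes C: "vec.subspace C" and d: "1 \<le> d" "d \<le> CARD('n)"
    and triv: "trivial_design d \<subseteq> supports_of_rank d (coord_matrix \<Gamma> ` C)"
  shows "CARD('Q) ^ (CARD('n) - d + 1) \<le> card C"
proof -
  have "d - 1 \<le> CARD('n)" using d by simp
  then obtain T :: "'n set" where T: "card T = d - 1"
    by (rule obtain_subset_with_card_n)
  have cT: "card (- T) = CARD('n) - d + 1"
    using T d by (simp add: Compl_eq_Diff_UNIV card_Diff_subset)
  have "\<exists>w\<in>C. w $ i \<noteq> 0 \<and> (\<forall>l. l \<notin> insert i T \<longrightarrow> w $ l = 0)" if i: "i \<notin> T" for i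
  proof -
    let ?U = "vec.span ((\<lambda>t. axis t (1::'q)) ` insert i T)"
    have "?U \<in> trivial_design d"
      unfolding trivial_design_def using dim_span_axes[of "insert i T", where 'a='q] T i d by simp
    then have "?U \<in> supports_of_rank d (coord_matrix \<Gamma> ` C)" using triv by blast
    then obtain w where w: "w \<in> C" "support (coord_matrix \<Gamma> w) = ?U" "rank (coord_matrix \<Gamma> w) = d"
      unfolding supports_of_rank_def by blast
    have van: "\<forall>l. l \<notin> insert i T \<longrightarrow> w $ l = 0"
      using support_subset_span_axes_iff[of w "insert i T"] w(2) by simp
    have "w $ i \<noteq> 0"
    proof
      assume "w $ i = 0"
      then have "rank (coord_matrix \<Gamma> w) \<le> card T"
        using van by (intro rank_le_card_coordinates) auto
      then show False using w T d by simp
    qed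
    then show ?thesis using w van by blast
  qed
  then obtain w where w: "\<And>i. i \<notin> T \<Longrightarrow> w i \<in> C" "\<And>i. i \<notin> T \<Longrightarrow> w i $ i \<noteq> 0"
    "\<And>i l. i \<notin> T \<Longrightarrow> l \<notin> T \<Longrightarrow> l \<noteq> i \<Longrightarrow> w i $ l = 0"
    by (metis insertE)
  define \<phi> where "\<phi> f = (\<Sum>i\<in>-T. f i *s w i)" for f :: "'n \<Rightarrow> 'Q"
  have coord: "\<phi> f $ l = f l * w l $ l" if "l \<notin> T" for f l
  proof -
    have "\<phi> f $ l = (\<Sum>i\<in>-T. if i = l then f l * w l $ l else 0)"
      unfolding \<phi>_def sum_component using that w(3) by (intro sum.cong) auto
    then show ?thesis using that by simp
  qed
  have "inj_on \<phi> (- T \<rightarrow>\<^sub>E UNIV)"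
  proof (rule inj_onI)
    fix f g :: "'n \<Rightarrow> 'Q"
    assume f: "f \<in> - T \<rightarrow>\<^sub>E UNIV" and g: "g \<in> - T \<rightarrow>\<^sub>E UNIV" and eq: "\<phi> f = \<phi> g"
    have "f l = g l" if "l \<in> - T" for l
      using coord[of l f] coord[of l g] w(2)[of l] that eq by simp
    then show "f = g" using f g by (intro PiE_ext) auto
  qed
  moreover have "\<phi> ` (- T \<rightarrow>\<^sub>E UNIV) \<subseteq> C"
    unfolding \<phi>_def using w(1) C by (auto intro!: vec.subspace_sum vec.subspace_scale)
  ultimately have "card (- T \<rightarrow>\<^sub>E (UNIV :: 'Q set)) \<le> card C"
    by (rule card_inj_on_le) simp
  then show ?thesis by (simp add: card_PiE cT)
qed

section \<open>Minimum distance and the MRD property\<close>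

lemma rank_coord_matrix_pos:
  fixes x :: "'Q^'n"
  assumes "x \<noteq> 0"
  shows "1 \<le> rank (coord_matrix \<Gamma> x)"
proof (rule ccontr)
  assume "\<not> ?thesis"
  then have "vec.dim (support (coord_matrix \<Gamma> x)) = 0"
    by (simp add: rank_eq_dim_support not_le)
  then have "support (coord_matrix \<Gamma> x) \<subseteq> {0}" by (simp only: vec.dim_eq_0)
  \<comment> \<open>The zero space is the coordinate subspace of no coordinates.\<close>
  also have "{0} = vec.span ((\<lambda>t. axis t 1) ` {})" by simp
  finally have "\<forall>i. x $ i = 0" unfolding support_subset_span_axes_iff by simp
  then show False using assms by (simp add: vec_eq_iff)
qed

lemma min_rank_distance_coord_matrix:
  fixes C :: "('Q^'n) set"
  assumes "vec.subspace C" "C \<noteq> {0}" and d: "min_rank_distance (coord_matrix \<Gamma> ` C) = d"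
  shows "1 \<le> d" "d \<le> CARD('n)"
    and "\<And>x. x \<in> C \<Longrightarrow> x \<noteq> 0 \<Longrightarrow> d \<le> rank (coord_matrix \<Gamma> x)"
proof -
  have zero: "coord_matrix \<Gamma> x = 0 \<longleftrightarrow> x = 0" for x :: "'Q^'n"
    using inj_coord_matrix coord_matrix_0 by (metis injD)
  let ?R = "rank ` (coord_matrix \<Gamma> ` C - {0})"
  have "0 \<in> C" using assms(1) vec.subspace_0 by blast
  then obtain x0 where "x0 \<in> C" "x0 \<noteq> 0" using assms(2) by blast
  then have "?R \<noteq> {}" using zero by blast
  then have "d \<in> ?R" using d unfolding min_rank_distance_def by (metis Min_in finite finite_imageI)
  then obtain x where x: "x \<in> C" "x \<noteq> 0" "d = rank (coord_matrix \<Gamma> x)" using zero by auto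
  show "1 \<le> d" using x rank_coord_matrix_pos by simp
  show "d \<le> CARD('n)" using x rank_le_card_coordinates[of UNIV x] by simp
  show "d \<le> rank (coord_matrix \<Gamma> x)" if "x \<in> C" "x \<noteq> 0" for x
  proof -
    have "rank (coord_matrix \<Gamma> x) \<in> ?R" using that zero by blast
    then have "Min ?R \<le> rank (coord_matrix \<Gamma> x)" by (intro Min_le) simp_all
    then show ?thesis using d by (simp only: min_rank_distance_def)
  qed
qed

text \<open>
  Both sides compare exponents of \<open>q\<close>: the code has \<open>q\<close> to its dimension many words, and
  the large field has \<open>q ^ m\<close> elements.
\<close>

lemma MRD_code_iff_card:
  fixes C :: "('Q^'n) set"
  assumes C: "vec.subspace C" "C \<noteq> {0}" and nm: "CARD('n) \<le> CARD('m)"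
    and d: "min_rank_distance (coord_matrix \<Gamma> ` C) = d"
  shows "MRD_code (coord_matrix \<Gamma> ` C) \<longleftrightarrow> card C = CARD('Q) ^ (CARD('n) - d + 1)"
proof -
  have q: "1 < CARD('q)"
    using card_mono[of UNIV "{0, 1::'q}"] by simp
  have "coord_matrix \<Gamma> ` C \<noteq> {0}"
    using C(2) coord_matrix_0 inj_coord_matrix
    by (metis image_empty image_insert inj_image_eq_iff)
  then have "MRD_code (coord_matrix \<Gamma> ` C) \<longleftrightarrow>
      mat.dim (coord_matrix \<Gamma> ` C) = CARD('m) * (CARD('n) - d + 1)"
    using nm d dim_coord_matrix_image(1)[OF C(1)] by (simp add: MRD_code_def max_def min_def)
  also have "\<dots> \<longleftrightarrow> CARD('q) ^ mat.dim (coord_matrix \<Gamma> ` C) = CARD('q) ^ (CARD('m) * (CARD('n) - d + 1))"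
    using q by (simp only: power_inject_exp)
  also have "\<dots> \<longleftrightarrow> card C = CARD('Q) ^ (CARD('n) - d + 1)"
    by (simp only: dim_coord_matrix_image(2)[OF C(1)] card_extension power_mult)
  finally show ?thesis .
qed

lemma card_iff_supports_trivial:
  fixes C :: "('Q^'n) set"
  assumes C: "vec.subspace C" "C \<noteq> {0}"
    and mrd: "min_rank_distance (coord_matrix \<Gamma> ` C) = d"
  shows "card C = CARD('Q) ^ (CARD('n) - d + 1) \<longleftrightarrow>
    supports_of_rank d (coord_matrix \<Gamma> ` C) = trivial_design d"
proof
  note d = min_rank_distance_coord_matrix[OF C mrd]
  assume card: "card C = CARD('Q) ^ (CARD('n) - d + 1)"
  show "supports_of_rank d (coord_matrix \<Gamma> ` C) = trivial_design d"
  proof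
    show "supports_of_rank d (coord_matrix \<Gamma> ` C) \<subseteq> trivial_design d"
      by (auto simp: supports_of_rank_def trivial_design_def subspace_support rank_eq_dim_support)
    show "trivial_design d \<subseteq> supports_of_rank d (coord_matrix \<Gamma> ` C)"
    proof
      fix U :: "('q^'n) set" assume "U \<in> trivial_design d"
      then have U: "vec.subspace U" "vec.dim U = d" by (auto simp: trivial_design_def)
      have Q: "1 < CARD('Q)"
        using card_mono[of UNIV "{0, 1::'Q}"] by simp
      have "card C * CARD('Q) ^ vec.dim U = CARD('Q) ^ Suc (CARD('n))"
        using d(2) by (simp add: card U(2) flip: power_add)
      then have "CARD('Q) ^ CARD('n) < card C * CARD('Q) ^ vec.dim U"
        using Q by simp
      from exists_word_supported_in_subspace[OF C(1) U(1) this]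
      obtain x where x: "x \<in> C" "x \<noteq> 0" "support (coord_matrix \<Gamma> x) \<subseteq> U" by blast
      have "support (coord_matrix \<Gamma> x) = U"
        using d(3)[OF x(1,2)] U x(3)
        by (intro vec.subspace_dim_equal subspace_support) (simp_all add: rank_eq_dim_support)
      then show "U \<in> supports_of_rank d (coord_matrix \<Gamma> ` C)"
        using x(1) U(2) by (auto simp: supports_of_rank_def rank_eq_dim_support)
    qed
  qed
next
  note d = min_rank_distance_coord_matrix[OF C mrd]
  assume "supports_of_rank d (coord_matrix \<Gamma> ` C) = trivial_design d"
  then show "card C = CARD('Q) ^ (CARD('n) - d + 1)"
    using singleton_bound[OF C(1) d] card_ge_if_supports_trivial[OF C(1) d(1,2)] by (simp add: le_antisym)
qed

end

text \<open>
  The expansion of \<open>x\<close> in \<open>\<Delta>\<close> exhibits \<open>x\<close> as a combination of the columns of its \<open>\<Delta>\<close>-matrix, with the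
  elements of \<open>\<Delta>\<close> as coefficients; taking \<open>\<Gamma>\<close>-coordinates of this combination gives one inclusion.
\<close>

lemma support_coord_matrix_basis_independent:
  fixes \<Gamma> \<Delta> :: "'m::finite \<Rightarrow> 'Q" and x :: "'Q^'n"
  assumes "is_basis \<Gamma>" "is_basis \<Delta>"
  shows "support (coord_matrix \<Gamma> x) = support (coord_matrix \<Delta> x)"
proof -
  have "support (coord_matrix \<Gamma> x) \<subseteq> support (coord_matrix \<Delta> x)"
    if "is_basis \<Gamma>" "is_basis \<Delta>" for \<Gamma> \<Delta> :: "'m \<Rightarrow> 'Q"
  proof -
    have "support (coord_matrix \<Gamma> x) \<subseteq> vec.span (range (\<lambda>j. column j (coord_matrix \<Delta> x)))"
      by (rule support_combination_subset[OF that(1), where y = \<Delta>])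
        (simp add: column_def flip: coord_matrix_expansion[OF that(2)])
    then show ?thesis by (simp add: support_def columns_def full_SetCompr_eq)
  qed
  then show ?thesis using assms by blast
qed

lemma min_rank_distance_basis_independent:
  fixes \<Gamma> \<Delta> :: "'m::finite \<Rightarrow> 'Q" and C :: "('Q^'n) set"
  assumes "is_basis \<Gamma>" "is_basis \<Delta>"
  shows "min_rank_distance (coord_matrix \<Gamma> ` C) = min_rank_distance (coord_matrix \<Delta> ` C)"
proof -
  have "coord_matrix \<Gamma> ` C - {0} = coord_matrix \<Gamma> ` (C - {0})" if "is_basis \<Gamma>" for \<Gamma> :: "'m \<Rightarrow> 'Q"
    using image_set_diff[OF inj_coord_matrix[OF that], of C "{0}"] by (simp add: coord_matrix_0[OF that])
  then show ?thesis
    unfolding min_rank_distance_def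
    by (simp add: assms image_image rank_eq_dim_support
        support_coord_matrix_basis_independent[OF assms])
qed

end

theorem proposition32:
  fixes emb :: "'q::{field,finite} \<Rightarrow> 'Q::{field,finite}"
    and \<Gamma> :: "'m::finite \<Rightarrow> 'Q"
    and C :: "('Q^'n::finite) set"
    and k d :: nat
  assumes "finite_field_extension emb"
    and "CARD('n) \<ge> 2" and "CARD('m) \<ge> 2" and "CARD('m) \<ge> CARD('n)"
    and "finite_field_extension.is_basis emb \<Gamma>"
    and "finite_field_extension.vector_code_params emb TYPE('m) C k d"
  shows "finite_field_extension.MRD_vector_code emb TYPE('m) C \<longleftrightarrow>
    supports_of_rank d (finite_field_extension.coord_matrix emb \<Gamma> ` C) = trivial_design d"
proof -
  interpret finite_field_extension emb by fact
  have C: "vector_code C" "vec.subspace C" "C \<noteq> {0}"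
    using assms(6) by (auto simp: vector_code_params_def vector_code_def)
  have dist: "min_rank_distance (coord_matrix \<Delta> ` C) = d" if "is_basis \<Delta>" for \<Delta> :: "'m \<Rightarrow> 'Q"
    using assms(6) min_rank_distance_basis_independent[OF that]
    by (auto simp: vector_code_params_def)
  have "MRD_code (coord_matrix \<Delta> ` C) \<longleftrightarrow> card C = CARD('Q) ^ (CARD('n) - d + 1)"
    if "is_basis \<Delta>" for \<Delta> :: "'m \<Rightarrow> 'Q"
    using MRD_code_iff_card[OF that C(2,3) assms(4) dist[OF that]] .
  then have "MRD_vector_code TYPE('m) C \<longleftrightarrow> card C = CARD('Q) ^ (CARD('n) - d + 1)"
    using C(1) assms(5) unfolding MRD_vector_code_def by blast
  then show ?thesis
    using card_iff_supports_trivial[OF assms(5) C(2,3) dist[OF assms(5)]] by simp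
qed

end
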